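(* Let $G$ be a $\overline{C}$-group, with a fixed $\overline{C}$-type presentation $\Pi$ with generator set $\Gamma$. Then $G$ fits into the exact sequence $$0\ \to\ \mathbb{Z}^{\mathfrak{C}_{\mathrm{ng}}(G)}\times\mathbb{Z}^{\mathfrak{C}_{\mathrm{fg}}(G)}\ \overset{\iota}{\to}\ A(G)\ \overset{\pi}{\to}\ G\ \to\ 0,$$ where $\iota$ sends the basis element $c_{\mathcal{O}}$ to $t_{\mathcal{O}}$ for each $\mathcal{O}\in\mathfrak{C}_{\mathrm{ng}}(G)\sqcup\mathfrak{C}_{\mathrm{fg}}(G)$.
   Context: For a group $G$, put $A(G)=\langle e_a,\ a\in G\mid e_ae_b=e_be_{b^{-1}ab},\ a,b\in G\rangle$, and let $\pi\colon A(G)\to G$ be the homomorphism $e_a\mapsto a$. For a set $X$, $\mathbb{Z}^X$ is the free abelian group with basis $(c_x)_{x\in X}$ (direct sum). A $\overline{C}$-group is a group $G$ admitting a presentation $\Pi$ (a $\overline{C}$-type presentation), with some generator set $\Gamma$, in which every relation is either a conjugation relation $b^{-1}ab=c$ with $a,b,c\in\Gamma$, or a power relation $a^k=1$ with $a\in\Gamma$, $k\ge 2$; there is at most one power relation per conjugacy class of $G$ (i.e., for each conjugacy class $\mathcal{O}$ of $G$, at most one power relation $a^k=1$ has $a\in\mathcal{O}$). $\mathfrak{C}_{\mathrm{ng}}(G)$ is the set of conjugacy classes of $G$ containing no element of $\Gamma$; $\mathfrak{C}_{\mathrm{fg}}(G)$ is the set of conjugacy classes of $G$ containing an element of $\Gamma$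 and consisting of elements of finite order. For $\mathcal{O}\in\mathfrak{C}_{\mathrm{fg}}(G)$, $k(\mathcal{O})$ is the order of its elements, equal to the exponent in the only power relation $a^k=1$ of $\Pi$ with $a\in\mathcal{O}$. For $\mathcal{O}\in\mathfrak{C}_{\mathrm{fg}}(G)$, $t_{\mathcal{O}}:=e_a^{k(\mathcal{O})}$ for $a\in\mathcal{O}$ (a central element of $A(G)$, independent of the choice of $a\in\mathcal{O}$). For $\mathcal{O}\in\mathfrak{C}_{\mathrm{ng}}(G)$, one chooses $a\in\mathcal{O}$ and an expression $a=a_1^{\alpha_1}\cdots a_s^{\alpha_s}$ with $a_i\in\Gamma$, $\alpha_i=\pm1$, and puts $t_{\mathcal{O}}:=e_a e_{a_s}^{-\alpha_s}\cdots e_{a_1}^{-\alpha_1}$. *)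

theory Defs
  imports "HOL-Algebra.Group_Action" "HOL-Algebra.Multiplicative_Group" "HOL-Algebra.Free_Abelian_Groups"
begin

section \<open>Group presentations\<close>

text \<open>A letter \<open>(x, True)\<close> stands for \<open>x\<close> and \<open>(x, False)\<close> for its formal inverse.\<close>

type_synonym 'g word = "('g \<times> bool) list"

definition words :: "'g set \<Rightarrow> 'g word set" where
  "words S = lists (S \<times> UNIV)"

definition word_inv :: "'g word \<Rightarrow> 'g word" where
  "word_inv w = rev (map (\<lambda>(x, s). (x, \<not> s)) w)"

definition word_eval :: "('a, 'b) monoid_scheme \<Rightarrow> ('g \<Rightarrow> 'a) \<Rightarrow> 'g word \<Rightarrow> 'a" where
  "word_eval G f w =
     foldr (\<lambda>(x, s) y. (if s then f x else inv\<^bsub>G\<^esub> f x) \<otimes>\<^bsub>G\<^esub> y) w \<one>\<^bsub>G\<^esub>"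

text \<open>A pair \<open>(r, s) \<in> R\<close> stands for the relation \<open>r = s\<close>.\<close>

inductive_set pres_cong :: "'g set \<Rightarrow> ('g word \<times> 'g word) set \<Rightarrow> ('g word \<times> 'g word) set"
  for S :: "'g set" and R :: "('g word \<times> 'g word) set" where
  refl: "u \<in> words S \<Longrightarrow> (u, u) \<in> pres_cong S R"
| sym: "(u, v) \<in> pres_cong S R \<Longrightarrow> (v, u) \<in> pres_cong S R"
| trans: "(u, v) \<in> pres_cong S R \<Longrightarrow> (v, w) \<in> pres_cong S R \<Longrightarrow> (u, w) \<in> pres_cong S R"
| cancel: "u \<in> words S \<Longrightarrow> v \<in> words S \<Longrightarrow> x \<in> S \<Longrightarrow>
    (u @ [(x, s), (x, \<not> s)] @ v, u @ v) \<in> pres_cong S R"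
| rel: "u \<in> words S \<Longrightarrow> v \<in> words S \<Longrightarrow> (r, s) \<in> R \<Longrightarrow> r \<in> words S \<Longrightarrow> s \<in> words S \<Longrightarrow>
    (u @ r @ v, u @ s @ v) \<in> pres_cong S R"

definition pres_class :: "'g set \<Rightarrow> ('g word \<times> 'g word) set \<Rightarrow> 'g word \<Rightarrow> 'g word set" where
  "pres_class S R w = pres_cong S R `` {w}"

definition presented_group :: "'g set \<Rightarrow> ('g word \<times> 'g word) set \<Rightarrow> 'g word set monoid" where
  "presented_group S R =
     \<lparr>carrier = words S // pres_cong S R,
      monoid.mult = (\<lambda>U V. \<Union>x\<in>U. \<Union>y\<in>V. pres_class S R (x @ y)),
      one = pres_class S R []\<rparr>"

definition pres_gen :: "'g set \<Rightarrow> ('g word \<times> 'g word) set \<Rightarrow> 'g \<Rightarrow> 'g word set" where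
  "pres_gen S R x = pres_class S R [(x, True)]"

text \<open>The map out of a presented group induced by a map \<open>f\<close> on generators.\<close>

definition pres_lift :: "('a, 'b) monoid_scheme \<Rightarrow> ('g \<Rightarrow> 'a) \<Rightarrow> 'g word set \<Rightarrow> 'a" where
  "pres_lift G f U = (THE y. \<exists>w\<in>U. y = word_eval G f w)"

text \<open>\<open>\<langle>S | R\<rangle>\<close> is a presentation of \<open>G\<close>, the generator \<open>x \<in> S\<close> denoting \<open>\<gamma> x\<close>;
  \<open>\<gamma>\<close> need not be injective.\<close>

definition presents ::
  "('a, 'b) monoid_scheme \<Rightarrow> 'g set \<Rightarrow> ('g \<Rightarrow> 'a) \<Rightarrow> ('g word \<times> 'g word) set \<Rightarrow> bool" where
  "presents G S \<gamma> R \<longleftrightarrow>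
     (\<exists>\<phi> \<in> iso (presented_group S R) G. \<forall>x\<in>S. \<phi> (pres_gen S R x) = \<gamma> x)"

lemma words_append [simp]: "u @ v \<in> words S \<longleftrightarrow> u \<in> words S \<and> v \<in> words S"
  by (auto simp: words_def)

lemma words_Nil [simp]: "[] \<in> words S"
  by (simp add: words_def)

lemma words_Cons [simp]: "(x, s) # w \<in> words S \<longleftrightarrow> x \<in> S \<and> w \<in> words S"
  by (auto simp: words_def)

lemma pres_cong_words: "(u, v) \<in> pres_cong S R \<Longrightarrow> u \<in> words S \<and> v \<in> words S"
  by (induction rule: pres_cong.induct) auto

lemma equiv_pres_cong: "equiv (words S) (pres_cong S R)"
proof (rule equivI)
  show "pres_cong S R \<subseteq> words S \<times> words S"
    using pres_cong_words by fast
  show "refl_on (words S) (pres_cong S R)"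
    by (simp add: refl_on_def pres_cong.refl)
  show "sym (pres_cong S R)"
    by (rule symI) (rule pres_cong.sym)
  show "trans (pres_cong S R)"
    by (rule transI) (rule pres_cong.trans)
qed

lemma pres_cong_context:
  assumes "(u, v) \<in> pres_cong S R" "p \<in> words S" "q \<in> words S"
  shows "(p @ u @ q, p @ v @ q) \<in> pres_cong S R"
  using assms
proof (induction rule: pres_cong.induct)
  case (refl u)
  then show ?case by (auto intro: pres_cong.refl)
next
  case (sym u v)
  then show ?case by (blast intro: pres_cong.sym)
next
  case (trans u v w)
  then show ?case by (blast intro: pres_cong.trans)
next
  case (cancel u v x s)
  then show ?case using pres_cong.cancel[of "p @ u" S "v @ q" x s R] by simp
next
  case (rel u v r s)
  then show ?case using pres_cong.rel[of "p @ u" S "v @ q" r s R] by simp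
qed

lemma pres_cong_append:
  assumes "(u, u') \<in> pres_cong S R" "(v, v') \<in> pres_cong S R"
  shows "(u @ v, u' @ v') \<in> pres_cong S R"
  using pres_cong_context[OF assms(1), of "[]" v] pres_cong_context[OF assms(2), of u' "[]"]
    assms[THEN pres_cong_words] by (simp add: pres_cong.trans[of "u @ v" "u' @ v"])

lemma pres_class_eq_iff:
  "u \<in> words S \<Longrightarrow> v \<in> words S \<Longrightarrow> pres_class S R u = pres_class S R v \<longleftrightarrow> (u, v) \<in> pres_cong S R"
  unfolding pres_class_def using eq_equiv_class_iff[OF equiv_pres_cong] by blast

lemma pres_class_mult:
  assumes "u \<in> words S" "v \<in> words S"
  shows "pres_class S R u \<otimes>\<^bsub>presented_group S R\<^esub> pres_class S R v = pres_class S R (u @ v)"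
proof -
  have "pres_class S R (x @ y) = pres_class S R (u @ v)"
    if "x \<in> pres_class S R u" "y \<in> pres_class S R v" for x y
  proof -
    have "(u, x) \<in> pres_cong S R" "(v, y) \<in> pres_cong S R"
      using that by (auto simp: pres_class_def)
    then have "(u @ v, x @ y) \<in> pres_cong S R" by (rule pres_cong_append)
    then show ?thesis using pres_class_eq_iff pres_cong_words by blast
  qed
  then have "(\<Union>x\<in>pres_class S R u. \<Union>y\<in>pres_class S R v. pres_class S R (x @ y)) =
      (\<Union>x\<in>pres_class S R u. \<Union>y\<in>pres_class S R v. pres_class S R (u @ v))"
    by (simp cong: SUP_cong)
  moreover have "u \<in> pres_class S R u" "v \<in> pres_class S R v"
    using assms by (auto simp: pres_class_def intro: pres_cong.refl)
  then have "pres_class S R u \<noteq> {}" "pres_class S R v \<noteq> {}" by blast+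
  ultimately show ?thesis by (simp add: presented_group_def)
qed

lemma carrier_presented_group: "carrier (presented_group S R) = pres_class S R ` words S"
  by (auto simp: presented_group_def pres_class_def quotient_def)

lemma one_presented_group: "\<one>\<^bsub>presented_group S R\<^esub> = pres_class S R []"
  by (simp add: presented_group_def)

lemma word_inv_words [simp]: "w \<in> words S \<Longrightarrow> word_inv w \<in> words S"
  by (auto simp: words_def word_inv_def lists_eq_set)

lemma word_inv_left: "w \<in> words S \<Longrightarrow> (word_inv w @ w, []) \<in> pres_cong S R"
proof (induction w)
  case Nil
  then show ?case by (simp add: word_inv_def pres_cong.refl)
next
  case (Cons a w)
  obtain x s where a: "a = (x, s)" by (cases a)
  have w: "w \<in> words S" "x \<in> S" using Cons.prems a by auto
  have "(word_inv w @ [(x, \<not> s), (x, \<not> \<not> s)] @ w, word_inv w @ w) \<in> pres_cong S R"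
    by (rule pres_cong.cancel) (use w in auto)
  then have "(word_inv w @ [(x, \<not> s), (x, \<not> \<not> s)] @ w, []) \<in> pres_cong S R"
    using Cons.IH[OF w(1)] by (rule pres_cong.trans)
  then show ?case using a by (simp add: word_inv_def)
qed

lemma group_presented_group: "group (presented_group S R)"
proof (rule groupI)
  show "\<And>x. x \<in> carrier (presented_group S R) \<Longrightarrow>
      \<exists>y\<in>carrier (presented_group S R). y \<otimes>\<^bsub>presented_group S R\<^esub> x = \<one>\<^bsub>presented_group S R\<^esub>"
  proof -
    fix U assume "U \<in> carrier (presented_group S R)"
    then obtain w where w: "w \<in> words S" "U = pres_class S R w"
      by (auto simp: carrier_presented_group)
    then show "\<exists>V\<in>carrier (presented_group S R). V \<otimes>\<^bsub>presented_group S R\<^esub> U = \<one>\<^bsub>presented_group S R\<^esub>"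
      using word_inv_left[OF w(1)]
      by (intro bexI[of _ "pres_class S R (word_inv w)"])
        (auto simp: carrier_presented_group pres_class_mult one_presented_group pres_class_eq_iff)
  qed
qed (auto simp: carrier_presented_group pres_class_mult one_presented_group)

lemma word_eval_Nil [simp]: "word_eval G f [] = \<one>\<^bsub>G\<^esub>"
  by (simp add: word_eval_def)

lemma word_eval_Cons [simp]:
  "word_eval G f ((x, s) # w) = (if s then f x else inv\<^bsub>G\<^esub> f x) \<otimes>\<^bsub>G\<^esub> word_eval G f w"
  by (simp add: word_eval_def)

lemma (in group) word_eval_closed:
  "f \<in> S \<rightarrow> carrier G \<Longrightarrow> w \<in> words S \<Longrightarrow> word_eval G f w \<in> carrier G"
  by (induction w) (auto simp: Pi_iff)

lemma (in group) word_eval_append: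
  "f \<in> S \<rightarrow> carrier G \<Longrightarrow> u \<in> words S \<Longrightarrow> v \<in> words S \<Longrightarrow>
    word_eval G f (u @ v) = word_eval G f u \<otimes> word_eval G f v"
  by (induction u) (auto simp: Pi_iff m_assoc word_eval_closed)

lemma (in group) word_eval_cong:
  assumes "(u, v) \<in> pres_cong S R" "f \<in> S \<rightarrow> carrier G"
    and "\<And>r s. (r, s) \<in> R \<Longrightarrow> word_eval G f r = word_eval G f s"
  shows "word_eval G f u = word_eval G f v"
  using assms(1)
proof (induction rule: pres_cong.induct)
  case (cancel u v x s)
  have x: "f x \<in> carrier G" using cancel assms(2) by auto
  have v: "word_eval G f v \<in> carrier G" using cancel word_eval_closed[OF assms(2)] by blast
  have "f x \<otimes> (inv f x \<otimes> word_eval G f v) = word_eval G f v"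
    and "inv f x \<otimes> (f x \<otimes> word_eval G f v) = word_eval G f v"
    using x v by (simp_all add: m_assoc[symmetric])
  then show ?case using cancel by (simp add: word_eval_append[OF assms(2)])
qed (auto simp: word_eval_append[OF assms(2)] assms(3))

lemma (in group) pres_lift_class:
  assumes "f \<in> S \<rightarrow> carrier G" "\<And>r s. (r, s) \<in> R \<Longrightarrow> word_eval G f r = word_eval G f s"
    and "w \<in> words S"
  shows "pres_lift G f (pres_class S R w) = word_eval G f w"
  unfolding pres_lift_def
proof (rule the_equality)
  show "\<exists>u\<in>pres_class S R w. word_eval G f w = word_eval G f u"
    using assms(3) by (auto simp: pres_class_def intro: pres_cong.refl)
  show "y = word_eval G f w" if "\<exists>u\<in>pres_class S R w. y = word_eval G f u" for y
    using that word_eval_cong[OF _ assms(1,2)] by (auto simp: pres_class_def)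
qed

lemma (in group) pres_lift_hom:
  assumes "f \<in> S \<rightarrow> carrier G" "\<And>r s. (r, s) \<in> R \<Longrightarrow> word_eval G f r = word_eval G f s"
  shows "pres_lift G f \<in> hom (presented_group S R) G"
  by (rule homI)
    (auto simp: carrier_presented_group pres_class_mult pres_lift_class[OF assms]
      word_eval_closed[OF assms(1)] word_eval_append[OF assms(1)])


section \<open>Conjugacy classes and \<open>C\<close>-bar-type presentations\<close>

definition conj_classes :: "('a, 'b) monoid_scheme \<Rightarrow> 'a set set" where
  "conj_classes G =
     orbits G (carrier G) (\<lambda>g. \<lambda>h \<in> carrier G. g \<otimes>\<^bsub>G\<^esub> h \<otimes>\<^bsub>G\<^esub> inv\<^bsub>G\<^esub> g)"

definition conj_rel :: "'g \<Rightarrow> 'g \<Rightarrow> 'g \<Rightarrow> 'g word \<times> 'g word" where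
  "conj_rel a b c = ([(b, False), (a, True), (b, True)], [(c, True)])"

definition power_rel :: "'g \<Rightarrow> nat \<Rightarrow> 'g word \<times> 'g word" where
  "power_rel a k = (replicate k (a, True), [])"

definition cbar_presentation ::
  "('a, 'b) monoid_scheme \<Rightarrow> 'g set \<Rightarrow> ('g \<Rightarrow> 'a) \<Rightarrow> ('g word \<times> 'g word) set \<Rightarrow> bool" where
  "cbar_presentation G \<Gamma> \<gamma> R \<longleftrightarrow>
     presents G \<Gamma> \<gamma> R \<and>
     (\<forall>r\<in>R. (\<exists>a\<in>\<Gamma>. \<exists>b\<in>\<Gamma>. \<exists>c\<in>\<Gamma>. r = conj_rel a b c) \<or>
            (\<exists>a\<in>\<Gamma>. \<exists>k\<ge>2. r = power_rel a k)) \<and>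
     (\<forall>\<O>\<in>conj_classes G. \<forall>a\<in>\<Gamma>. \<forall>b\<in>\<Gamma>. \<forall>k\<ge>2. \<forall>l\<ge>2.
        power_rel a k \<in> R \<and> \<gamma> a \<in> \<O> \<and> power_rel b l \<in> R \<and> \<gamma> b \<in> \<O> \<longrightarrow>
        power_rel a k = power_rel b l)"

text \<open>In the following two definitions \<open>T\<close> is the set of elements of \<open>G\<close> denoted by the generators.\<close>

definition conj_classes_ng :: "('a, 'b) monoid_scheme \<Rightarrow> 'a set \<Rightarrow> 'a set set" where
  "conj_classes_ng G T = {\<O> \<in> conj_classes G. \<O> \<inter> T = {}}"

definition conj_classes_fg :: "('a, 'b) monoid_scheme \<Rightarrow> 'a set \<Rightarrow> 'a set set" where
  "conj_classes_fg G T =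
     {\<O> \<in> conj_classes G. \<O> \<inter> T \<noteq> {} \<and> (\<forall>a\<in>\<O>. \<exists>n::nat. n > 0 \<and> a [^]\<^bsub>G\<^esub> n = \<one>\<^bsub>G\<^esub>)}"

definition class_order :: "('a, 'b) monoid_scheme \<Rightarrow> 'a set \<Rightarrow> nat" where
  "class_order G \<O> = (THE k. \<forall>a\<in>\<O>. group.ord G a = k)"

lemma (in group) pow_conj_eq_one_iff:
  assumes "g \<in> carrier G" "x \<in> carrier G"
  shows "(g \<otimes> x \<otimes> inv g) [^] (n::nat) = \<one> \<longleftrightarrow> x [^] n = \<one>"
proof -
  have "(g \<otimes> x \<otimes> inv g) [^] n = g \<otimes> x [^] n \<otimes> inv g"
  proof (induction n)
    case (Suc n)
    have "inv g \<otimes> (g \<otimes> (x \<otimes> inv g)) = x \<otimes> inv g"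
      using assms by (simp add: m_assoc[symmetric])
    then show ?case using assms Suc by (simp add: m_assoc)
  qed (use assms in simp)
  moreover have "g \<otimes> x [^] n \<otimes> inv g = \<one> \<longleftrightarrow> x [^] n = \<one>"
    using assms conjugation_is_inj[of g "x [^] n" \<one>] by auto
  ultimately show ?thesis by simp
qed

lemma (in group) class_order_eq:
  assumes "\<O> \<in> conj_classes G" "a \<in> \<O>"
  shows "class_order G \<O> = ord a"
proof -
  obtain x where x: "x \<in> carrier G" and
    O: "\<O> = {g \<otimes> x \<otimes> inv g | g. g \<in> carrier G}"
    using assms(1) by (auto simp: conj_classes_def orbits_def orbit_def)
  have "ord b = ord x" if "b \<in> \<O>" for b
    using that O x by (auto simp: ord_def pow_conj_eq_one_iff)
  then show ?thesis unfolding class_order_def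
    using assms(2) by (intro the_equality) auto
qed


section \<open>The group \<open>A(G)\<close>\<close>

definition A_rels :: "('a, 'b) monoid_scheme \<Rightarrow> ('a word \<times> 'a word) set" where
  "A_rels G =
     {([(a, True), (b, True)], [(b, True), (inv\<^bsub>G\<^esub> b \<otimes>\<^bsub>G\<^esub> a \<otimes>\<^bsub>G\<^esub> b, True)]) | a b.
        a \<in> carrier G \<and> b \<in> carrier G}"

definition A_group :: "('a, 'b) monoid_scheme \<Rightarrow> 'a word set monoid" where
  "A_group G = presented_group (carrier G) (A_rels G)"

definition A_gen :: "('a, 'b) monoid_scheme \<Rightarrow> 'a \<Rightarrow> 'a word set" where
  "A_gen G a = pres_gen (carrier G) (A_rels G) a"

definition A_proj :: "('a, 'b) monoid_scheme \<Rightarrow> 'a word set \<Rightarrow> 'a" where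
  "A_proj G = pres_lift G (\<lambda>a. a)"

lemma (in group) A_rels_eval:
  "(r, s) \<in> A_rels G \<Longrightarrow> word_eval G (\<lambda>a. a) r = word_eval G (\<lambda>a. a) s"
  by (auto simp: A_rels_def m_assoc[symmetric])

lemma (in group) A_proj_hom: "A_proj G \<in> hom (A_group G) G"
  unfolding A_proj_def A_group_def by (rule pres_lift_hom) (auto dest: A_rels_eval)

lemma (in group) A_proj_gen: "a \<in> carrier G \<Longrightarrow> A_proj G (A_gen G a) = a"
  unfolding A_proj_def A_gen_def pres_gen_def
  by (subst pres_lift_class) (auto dest: A_rels_eval)

text \<open>For \<open>w = a\<^sub>1\<^bsup>\<alpha>\<^sub>1\<^esup> \<cdots> a\<^sub>s\<^bsup>\<alpha>\<^sub>s\<^esup>\<close>, the element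
  \<open>e\<^sub>a e\<^bsub>a\<^sub>s\<^esub>\<^bsup>-\<alpha>\<^sub>s\<^esup> \<cdots> e\<^bsub>a\<^sub>1\<^esub>\<^bsup>-\<alpha>\<^sub>1\<^esup>\<close> of \<open>A(G)\<close>.\<close>

definition t_ng :: "('a, 'b) monoid_scheme \<Rightarrow> ('g \<Rightarrow> 'a) \<Rightarrow> 'a \<Rightarrow> 'g word \<Rightarrow> 'a word set" where
  "t_ng G \<gamma> a w =
     A_gen G a \<otimes>\<^bsub>A_group G\<^esub> word_eval (A_group G) (\<lambda>x. A_gen G (\<gamma> x)) (word_inv w)"

text \<open>The library's exact sequences live in a single type, hence this version.\<close>

definition short_exact ::
  "('a, 'm) monoid_scheme \<Rightarrow> ('b, 'n) monoid_scheme \<Rightarrow> ('c, 'k) monoid_scheme \<Rightarrow>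
   ('a \<Rightarrow> 'b) \<Rightarrow> ('b \<Rightarrow> 'c) \<Rightarrow> bool" where
  "short_exact K E Q f g \<longleftrightarrow>
     group_hom K E f \<and> group_hom E Q g \<and>
     inj_on f (carrier K) \<and> f ` carrier K = kernel E Q g \<and> g ` carrier E = carrier Q"

end

theory Submission
  imports Defs "HOL-Algebra.SndIsomorphismGrp"
begin

text \<open>Conjugation by \<open>y \<in> A(G)\<close> sends \<open>e\<^sub>a\<close> to the generator at \<open>\<pi>(y) a \<pi>(y)\<^sup>-\<^sup>1\<close>, so \<open>ker \<pi>\<close> is
  central and \<open>\<iota>\<close> is a well-defined homomorphism into it. Counting the letters of a word that lie in
  a given conjugacy class gives homomorphisms \<open>A(G) \<rightarrow> \<int>\<close>, with respect to which the
  \<open>t\<^sub>\<O>\<close> form a triangular system with nonzero diagonal; hence \<open>\<iota>\<close> is injective. Let \<open>N\<close> be the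
  image of \<open>\<iota>\<close>. Modulo \<open>N\<close> the generators \<open>e\<^sub>a\<close> with \<open>a \<in> \<Gamma>\<close> satisfy the relations of \<open>G\<close>, the
  exponent of a power relation being the order of its generator. They also generate \<open>A(G)/N\<close>, because
  every conjugacy class contains some \<open>a\<close> for which \<open>e\<^sub>a\<close> is modulo \<open>N\<close> a word in them. Hence
  \<open>A(G)/N \<rightarrow> G\<close> is injective.\<close>

section \<open>Words and presented groups\<close>

lemma (in group_hom) hom_word_eval:
  assumes "f \<in> S \<rightarrow> carrier G" "\<And>x. x \<in> S \<Longrightarrow> h (f x) = f' x" "w \<in> words S"
  shows "h (word_eval G f w) = word_eval H f' w"
  using assms(3)
proof (induction w)
  case (Cons l w)
  obtain x s where l: "l = (x, s)" by (cases l)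
  have "f x \<in> carrier G" "word_eval G f w \<in> carrier G"
    using Cons.prems l assms(1) G.word_eval_closed[OF assms(1)] by auto
  then show ?case using Cons l assms(2) by auto
qed simp

lemma (in group) word_eval_word_inv:
  assumes "f \<in> S \<rightarrow> carrier G" "w \<in> words S"
  shows "word_eval G f (word_inv w) = inv (word_eval G f w)"
proof -
  \<comment> \<open>Taking \<open>R = {}\<close> leaves only free cancellation, so the values of
    \<open>f\<close> have no relation to respect.\<close>
  have "word_eval G f (word_inv w @ w) = word_eval G f []"
    using word_eval_cong[OF word_inv_left[OF assms(2), where R = "{}"] assms(1)] by simp
  then have "word_eval G f (word_inv w) \<otimes> word_eval G f w = \<one>"
    using word_eval_append[OF assms(1)] assms(2) by simp
  then show ?thesis
    using inv_equality word_eval_closed[OF assms(1)] assms(2) word_inv_words by metis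
qed

lemma (in group) word_eval_replicate:
  "f x \<in> carrier G \<Longrightarrow> word_eval G f (replicate n (x, True)) = f x [^] n"
  using nat_pow_Suc2 by (induction n) auto

lemma words_replicate: "x \<in> S \<Longrightarrow> replicate n (x, s) \<in> words S"
  by (induction n) auto

lemma pres_gen_closed: "x \<in> S \<Longrightarrow> pres_gen S R x \<in> carrier (presented_group S R)"
  by (auto simp: pres_gen_def carrier_presented_group)

lemma inv_pres_gen:
  assumes "x \<in> S"
  shows "inv\<^bsub>presented_group S R\<^esub> pres_gen S R x = pres_class S R [(x, False)]"
proof -
  interpret P: group "presented_group S R" by (rule group_presented_group)
  have "([] @ [(x, False), (x, \<not> False)] @ [], [] @ []) \<in> pres_cong S R"
    by (rule pres_cong.cancel) (use assms in auto)
  then have "pres_class S R [(x, False)] \<otimes>\<^bsub>presented_group S R\<^esub> pres_gen S R x =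
      \<one>\<^bsub>presented_group S R\<^esub>"
    using assms by (simp add: pres_gen_def pres_class_mult one_presented_group pres_class_eq_iff)
  then show ?thesis
    using P.inv_equality assms pres_gen_closed[OF assms] by (simp add: carrier_presented_group)
qed

text \<open>Rewriting a class as the value of a word in the generators makes
  \<open>hom_word_eval\<close> applicable to maps out of a presented group.\<close>

lemma word_eval_pres_gen:
  "w \<in> words S \<Longrightarrow> word_eval (presented_group S R) (pres_gen S R) w = pres_class S R w"
proof (induction w)
  case Nil
  then show ?case by (simp add: one_presented_group)
next
  case (Cons l w)
  obtain x s where l: "l = (x, s)" by (cases l)
  have x: "x \<in> S" and w: "w \<in> words S" using Cons.prems l by auto
  have "(if s then pres_gen S R x else inv\<^bsub>presented_group S R\<^esub> pres_gen S R x) =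
      pres_class S R [(x, s)]"
    using x by (simp add: inv_pres_gen) (simp add: pres_gen_def)
  then show ?case
    using Cons.IH[OF w] x w l by (simp add: pres_class_mult)
qed

lemma carrier_presented_group_word_eval:
  "carrier (presented_group S R) =
     word_eval (presented_group S R) (pres_gen S R) ` words S"
  by (auto simp: carrier_presented_group word_eval_pres_gen)

lemma (in group) word_eval_in_subgroup:
  assumes "subgroup H G" "\<And>x. x \<in> S \<Longrightarrow> f x \<in> H" "w \<in> words S"
  shows "word_eval G f w \<in> H"
  using assms(3)
  by (induction w)
    (auto simp: assms(2) subgroup.one_closed[OF assms(1)] subgroup.m_closed[OF assms(1)]
      subgroup.m_inv_closed[OF assms(1)])

text \<open>This acts as induction over a presented group: a property whose elements form a subgroup
  has to be checked on generators only.\<close>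

lemma presented_group_subset_subgroup:
  assumes "subgroup H (presented_group S R)" "\<And>x. x \<in> S \<Longrightarrow> pres_gen S R x \<in> H"
  shows "carrier (presented_group S R) \<subseteq> H"
  using group.word_eval_in_subgroup[OF group_presented_group assms]
  by (auto simp: carrier_presented_group_word_eval)

lemma (in group) subgroup_word_evals:
  assumes "f \<in> S \<rightarrow> carrier G"
  shows "subgroup (word_eval G f ` words S) G"
proof (rule subgroupI)
  show "word_eval G f ` words S \<noteq> {}" using words_Nil by blast
next
  fix y assume "y \<in> word_eval G f ` words S"
  then obtain w where "w \<in> words S" "y = word_eval G f w" by auto
  then show "inv y \<in> word_eval G f ` words S"
    using word_eval_word_inv[OF assms, of w] word_inv_words[of w S] by (metis image_eqI)
next
  fix y z assume "y \<in> word_eval G f ` words S" "z \<in> word_eval G f ` words S"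
  then obtain u v where "u \<in> words S" "v \<in> words S" "y = word_eval G f u" "z = word_eval G f v"
    by auto
  then show "y \<otimes> z \<in> word_eval G f ` words S"
    using word_eval_append[OF assms, of u v] words_append by (metis image_eqI)
qed (use word_eval_closed[OF assms] in auto)

text \<open>The isomorphism sends the class of a word to its value, so its bijectivity becomes a
  statement about words. Later arguments use these three facts and never the isomorphism
  itself.\<close>

lemma (in group)
  assumes "presents G S \<gamma> R"
  shows presents_gen_closed: "\<gamma> \<in> S \<rightarrow> carrier G"
    and presents_word_eval_surj: "word_eval G \<gamma> ` words S = carrier G"
    and presents_cong_iff: "\<lbrakk>u \<in> words S; v \<in> words S\<rbrakk> \<Longrightarrow>
       (u, v) \<in> pres_cong S R \<longleftrightarrow> word_eval G \<gamma> u = word_eval G \<gamma> v"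
proof -
  obtain \<phi> where \<phi>: "\<phi> \<in> iso (presented_group S R) G"
    and gen: "\<And>x. x \<in> S \<Longrightarrow> \<phi> (pres_gen S R x) = \<gamma> x"
    using assms by (auto simp: presents_def)
  interpret \<phi>: group_hom "presented_group S R" G \<phi>
    using \<phi> group_presented_group is_group
    by (auto simp: group_hom_def group_hom_axioms_def iso_def)
  have bij: "bij_betw \<phi> (carrier (presented_group S R)) (carrier G)"
    using \<phi> by (simp add: iso_def)
  have ev: "\<phi> (pres_class S R w) = word_eval G \<gamma> w" if "w \<in> words S" for w
    using \<phi>.hom_word_eval[of "pres_gen S R" S \<gamma> w] that gen pres_gen_closed[of _ S R]
    by (simp add: word_eval_pres_gen Pi_iff)
  show "\<gamma> \<in> S \<rightarrow> carrier G"
    using \<phi>.hom_closed[OF pres_gen_closed[of _ S R]] gen by auto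
  have "carrier G = \<phi> ` pres_class S R ` words S"
    using bij by (simp add: bij_betw_def carrier_presented_group)
  then show "word_eval G \<gamma> ` words S = carrier G"
    using ev by (auto simp: image_image)
  show "(u, v) \<in> pres_cong S R \<longleftrightarrow> word_eval G \<gamma> u = word_eval G \<gamma> v"
    if uv: "u \<in> words S" "v \<in> words S"
  proof -
    have "\<phi> (pres_class S R u) = \<phi> (pres_class S R v) \<longleftrightarrow> pres_class S R u = pres_class S R v"
      using bij uv by (auto simp: bij_betw_def carrier_presented_group dest: inj_onD)
    then show ?thesis using uv by (simp add: ev pres_class_eq_iff)
  qed
qed

section \<open>Conjugacy classes\<close>

lemma (in group) conj_classes_eq:
  "conj_classes G = {{g \<otimes> x \<otimes> inv g | g. g \<in> carrier G} | x. x \<in> carrier G}"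
proof -
  have "orbit G (\<lambda>g. \<lambda>h\<in>carrier G. g \<otimes> h \<otimes> inv g) x = {g \<otimes> x \<otimes> inv g | g. g \<in> carrier G}"
    if "x \<in> carrier G" for x
    using that by (auto simp: orbit_def)
  then show ?thesis unfolding conj_classes_def orbits_def by auto
qed

lemma (in group) conj_class_closed: "\<O> \<in> conj_classes G \<Longrightarrow> a \<in> \<O> \<Longrightarrow> a \<in> carrier G"
  by (auto simp: conj_classes_eq)

lemma (in group) conj_class_exists:
  assumes "a \<in> carrier G"
  obtains \<O> where "\<O> \<in> conj_classes G" "a \<in> \<O>"
proof
  show "{g \<otimes> a \<otimes> inv g | g. g \<in> carrier G} \<in> conj_classes G"
    using assms by (auto simp: conj_classes_eq)
  have "a = \<one> \<otimes> a \<otimes> inv \<one>" using assms by simp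
  then show "a \<in> {g \<otimes> a \<otimes> inv g | g. g \<in> carrier G}" by blast
qed

lemma (in group) conj_class_eq:
  assumes "\<O> \<in> conj_classes G" "a \<in> \<O>"
  shows "\<O> = {g \<otimes> a \<otimes> inv g | g. g \<in> carrier G}"
proof -
  obtain x where x: "x \<in> carrier G" and \<O>: "\<O> = {g \<otimes> x \<otimes> inv g | g. g \<in> carrier G}"
    using assms(1) by (auto simp: conj_classes_eq)
  obtain h where h: "h \<in> carrier G" "a = h \<otimes> x \<otimes> inv h"
    using assms(2) \<O> by auto
  have "inv h \<otimes> (h \<otimes> y) = y" if "y \<in> carrier G" for y
    using that h(1) by (simp add: m_assoc[symmetric])
  then have "g \<otimes> x \<otimes> inv g = (g \<otimes> inv h) \<otimes> a \<otimes> inv (g \<otimes> inv h)"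
    and "g \<otimes> a \<otimes> inv g = (g \<otimes> h) \<otimes> x \<otimes> inv (g \<otimes> h)" if "g \<in> carrier G" for g
    using that h x by (simp_all add: inv_mult_group m_assoc)
  then show ?thesis unfolding \<O> using h by blast
qed

lemma (in group) conj_class_unique:
  "\<lbrakk>\<O> \<in> conj_classes G; \<O>' \<in> conj_classes G; a \<in> \<O>; a \<in> \<O>'\<rbrakk> \<Longrightarrow> \<O> = \<O>'"
  using conj_class_eq[of \<O> a] conj_class_eq[of \<O>' a] by simp

text \<open>This invariance lets the indicator function of a class respect conjugation relations,
  both in A(G) and in the given presentation.\<close>

lemma (in group) conj_class_conj_iff:
  assumes "\<O> \<in> conj_classes G" "a \<in> carrier G" "b \<in> carrier G"
  shows "b \<otimes> a \<otimes> inv b \<in> \<O> \<longleftrightarrow> a \<in> \<O>"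
proof -
  obtain \<O>' where \<O>': "\<O>' \<in> conj_classes G" "a \<in> \<O>'"
    using conj_class_exists assms(2) .
  then have "b \<otimes> a \<otimes> inv b \<in> \<O>'"
    using conj_class_eq assms(3) by blast
  then show ?thesis using conj_class_unique assms(1) \<O>' by metis
qed

section \<open>The group \<open>A(G)\<close> as a central extension\<close>

lemma (in group) group_A_group: "group (A_group G)"
  unfolding A_group_def by (rule group_presented_group)

lemma (in group) A_proj_group_hom: "group_hom (A_group G) G (A_proj G)"
  using group_A_group A_proj_hom is_group by (simp add: group_hom_def group_hom_axioms_def)

lemma (in group) A_gen_closed: "a \<in> carrier G \<Longrightarrow> A_gen G a \<in> carrier (A_group G)"
  unfolding A_gen_def A_group_def by (rule pres_gen_closed)

lemma (in group) A_gen_rel: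
  assumes "a \<in> carrier G" "b \<in> carrier G"
  shows "A_gen G a \<otimes>\<^bsub>A_group G\<^esub> A_gen G b =
    A_gen G b \<otimes>\<^bsub>A_group G\<^esub> A_gen G (inv b \<otimes> a \<otimes> b)"
proof -
  have "([] @ [(a, True), (b, True)] @ [], [] @ [(b, True), (inv b \<otimes> a \<otimes> b, True)] @ [])
      \<in> pres_cong (carrier G) (A_rels G)"
    by (rule pres_cong.rel) (use assms in \<open>auto simp: A_rels_def\<close>)
  then show ?thesis
    using assms by (simp add: A_gen_def A_group_def pres_gen_def pres_class_mult pres_class_eq_iff)
qed

text \<open>For a generator y this is a defining relation of A(G). The elements y for which the
  formula holds at every a form a subgroup \<open>H\<close>, which is therefore everything. The
  quantifier over a belongs inside \<open>H\<close>, since closure under products and inverses uses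
  the formula at conjugates of a.\<close>

lemma (in group) A_gen_conj:
  assumes "y \<in> carrier (A_group G)" "a \<in> carrier G"
  shows "y \<otimes>\<^bsub>A_group G\<^esub> A_gen G a \<otimes>\<^bsub>A_group G\<^esub> inv\<^bsub>A_group G\<^esub> y =
    A_gen G (A_proj G y \<otimes> a \<otimes> inv A_proj G y)"
proof -
  interpret A: group "A_group G" by (rule group_A_group)
  interpret \<pi>: group_hom "A_group G" G "A_proj G" by (rule A_proj_group_hom)
  define H where "H = {y \<in> carrier (A_group G). \<forall>a\<in>carrier G.
    y \<otimes>\<^bsub>A_group G\<^esub> A_gen G a \<otimes>\<^bsub>A_group G\<^esub> inv\<^bsub>A_group G\<^esub> y =
    A_gen G (A_proj G y \<otimes> a \<otimes> inv A_proj G y)}"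
  have "subgroup H (A_group G)"
  proof (rule A.subgroupI)
    show "H \<subseteq> carrier (A_group G)" by (auto simp: H_def)
    have "\<one>\<^bsub>A_group G\<^esub> \<in> H" using A_gen_closed by (simp add: H_def)
    then show "H \<noteq> {}" by blast
  next
    fix y assume y: "y \<in> H"
    then have yc [simp]: "y \<in> carrier (A_group G)" by (simp add: H_def)
    show "inv\<^bsub>A_group G\<^esub> y \<in> H"
      unfolding H_def
    proof (intro CollectI conjI ballI)
      fix a assume a: "a \<in> carrier G"
      \<comment> \<open>The formula for y at this b has right-hand side \<open>A_gen G a\<close>;
        solved for \<open>A_gen G b\<close>, it is the formula for the inverse of y at a.\<close>
      define b where "b = inv A_proj G y \<otimes> a \<otimes> A_proj G y"
      have b: "b \<in> carrier G" using a by (simp add: b_def)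
      have "A_proj G y \<otimes> b \<otimes> inv A_proj G y = a"
        using a unfolding b_def by (simp add: m_assoc) (simp add: m_assoc[symmetric])
      then have "y \<otimes>\<^bsub>A_group G\<^esub> A_gen G b \<otimes>\<^bsub>A_group G\<^esub> inv\<^bsub>A_group G\<^esub> y = A_gen G a"
        using y b by (simp add: H_def)
      then have "inv\<^bsub>A_group G\<^esub> y \<otimes>\<^bsub>A_group G\<^esub> A_gen G a \<otimes>\<^bsub>A_group G\<^esub> y =
          inv\<^bsub>A_group G\<^esub> y \<otimes>\<^bsub>A_group G\<^esub>
            (y \<otimes>\<^bsub>A_group G\<^esub> A_gen G b \<otimes>\<^bsub>A_group G\<^esub> inv\<^bsub>A_group G\<^esub> y) \<otimes>\<^bsub>A_group G\<^esub> y"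
        by simp
      also have "\<dots> = A_gen G b"
        using A_gen_closed[OF b] by (simp add: A.m_assoc) (simp add: A.m_assoc[symmetric])
      finally show "inv\<^bsub>A_group G\<^esub> y \<otimes>\<^bsub>A_group G\<^esub> A_gen G a \<otimes>\<^bsub>A_group G\<^esub>
          inv\<^bsub>A_group G\<^esub> (inv\<^bsub>A_group G\<^esub> y) =
        A_gen G (A_proj G (inv\<^bsub>A_group G\<^esub> y) \<otimes> a \<otimes> inv A_proj G (inv\<^bsub>A_group G\<^esub> y))"
        by (simp add: b_def)
    qed simp
  next
    fix y z assume yz: "y \<in> H" "z \<in> H"
    then have [simp]: "y \<in> carrier (A_group G)" "z \<in> carrier (A_group G)" by (simp_all add: H_def)
    show "y \<otimes>\<^bsub>A_group G\<^esub> z \<in> H"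
      unfolding H_def
    proof (intro CollectI conjI ballI)
      fix a assume a: "a \<in> carrier G"
      define b where "b = A_proj G z \<otimes> a \<otimes> inv A_proj G z"
      have b: "b \<in> carrier G" using a by (simp add: b_def)
      have "y \<otimes>\<^bsub>A_group G\<^esub> z \<otimes>\<^bsub>A_group G\<^esub> A_gen G a \<otimes>\<^bsub>A_group G\<^esub>
          inv\<^bsub>A_group G\<^esub> (y \<otimes>\<^bsub>A_group G\<^esub> z) =
        y \<otimes>\<^bsub>A_group G\<^esub> (z \<otimes>\<^bsub>A_group G\<^esub> A_gen G a \<otimes>\<^bsub>A_group G\<^esub> inv\<^bsub>A_group G\<^esub> z)
          \<otimes>\<^bsub>A_group G\<^esub> inv\<^bsub>A_group G\<^esub> y"
        using A_gen_closed[OF a] by (simp add: A.m_assoc A.inv_mult_group)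
      also have "\<dots> = A_gen G (A_proj G y \<otimes> b \<otimes> inv A_proj G y)"
        using yz a b by (simp add: H_def b_def)
      also have "A_proj G y \<otimes> b \<otimes> inv A_proj G y =
          A_proj G (y \<otimes>\<^bsub>A_group G\<^esub> z) \<otimes> a \<otimes> inv A_proj G (y \<otimes>\<^bsub>A_group G\<^esub> z)"
        using a by (simp add: b_def m_assoc inv_mult_group)
      finally show "y \<otimes>\<^bsub>A_group G\<^esub> z \<otimes>\<^bsub>A_group G\<^esub> A_gen G a \<otimes>\<^bsub>A_group G\<^esub>
          inv\<^bsub>A_group G\<^esub> (y \<otimes>\<^bsub>A_group G\<^esub> z) =
        A_gen G (A_proj G (y \<otimes>\<^bsub>A_group G\<^esub> z) \<otimes> a \<otimes> inv A_proj G (y \<otimes>\<^bsub>A_group G\<^esub> z))" .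
    qed simp
  qed
  moreover have "A_gen G b \<in> H" if b: "b \<in> carrier G" for b
    unfolding H_def
  proof (intro CollectI conjI ballI)
    show "A_gen G b \<in> carrier (A_group G)" using A_gen_closed b .
    fix a assume a: "a \<in> carrier G"
    \<comment> \<open>With this c the defining relation for the pair c, b has
      \<open>A_gen G a\<close> as its last factor.\<close>
    define c where "c = b \<otimes> a \<otimes> inv b"
    have c: "c \<in> carrier G" using a b by (simp add: c_def)
    have "inv b \<otimes> c \<otimes> b = a"
      using a b unfolding c_def by (simp add: m_assoc) (simp add: m_assoc[symmetric])
    then have "A_gen G c \<otimes>\<^bsub>A_group G\<^esub> A_gen G b = A_gen G b \<otimes>\<^bsub>A_group G\<^esub> A_gen G a"
      using A_gen_rel[OF c b] by simp
    then have "A_gen G b \<otimes>\<^bsub>A_group G\<^esub> A_gen G a \<otimes>\<^bsub>A_group G\<^esub> inv\<^bsub>A_group G\<^esub> A_gen G b = A_gen G c"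
      using A.inv_solve_right A_gen_closed a b c A.m_closed by metis
    then show "A_gen G b \<otimes>\<^bsub>A_group G\<^esub> A_gen G a \<otimes>\<^bsub>A_group G\<^esub> inv\<^bsub>A_group G\<^esub> A_gen G b =
      A_gen G (A_proj G (A_gen G b) \<otimes> a \<otimes> inv A_proj G (A_gen G b))"
      using b by (simp add: A_proj_gen c_def)
  qed
  ultimately have "carrier (A_group G) \<subseteq> H"
    using presented_group_subset_subgroup unfolding A_group_def A_gen_def by blast
  then show ?thesis using assms by (auto simp: H_def)
qed

text \<open>By \<open>A_gen_conj\<close> an element over 1 conjugates each generator to itself. Its
  centralizer is a subgroup containing all generators.\<close>

lemma (in group) kernel_A_proj_central:
  assumes "z \<in> kernel (A_group G) G (A_proj G)" "y \<in> carrier (A_group G)"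
  shows "y \<otimes>\<^bsub>A_group G\<^esub> z = z \<otimes>\<^bsub>A_group G\<^esub> y"
proof -
  interpret A: group "A_group G" by (rule group_A_group)
  have z [simp]: "z \<in> carrier (A_group G)" and z1: "A_proj G z = \<one>"
    using assms(1) by (auto simp: kernel_def)
  define H where "H = {y \<in> carrier (A_group G). y \<otimes>\<^bsub>A_group G\<^esub> z = z \<otimes>\<^bsub>A_group G\<^esub> y}"
  have "subgroup H (A_group G)"
  proof (rule A.subgroupI)
    show "H \<subseteq> carrier (A_group G)" by (auto simp: H_def)
    have "\<one>\<^bsub>A_group G\<^esub> \<in> H" by (simp add: H_def)
    then show "H \<noteq> {}" by blast
  next
    fix y assume y: "y \<in> H"
    then have [simp]: "y \<in> carrier (A_group G)" by (simp add: H_def)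
    have "z \<otimes>\<^bsub>A_group G\<^esub> inv\<^bsub>A_group G\<^esub> y = inv\<^bsub>A_group G\<^esub> y \<otimes>\<^bsub>A_group G\<^esub> z"
      using y A.inv_solve_left A.inv_solve_right
      by (simp add: H_def) (metis A.inv_closed A.m_assoc A.m_closed \<open>y \<in> carrier (A_group G)\<close> z)
    then show "inv\<^bsub>A_group G\<^esub> y \<in> H" by (simp add: H_def)
  next
    fix x y assume "x \<in> H" "y \<in> H"
    then show "x \<otimes>\<^bsub>A_group G\<^esub> y \<in> H"
      by (simp add: H_def A.m_assoc) (simp add: A.m_assoc[symmetric])
  qed
  moreover have "A_gen G a \<in> H" if a: "a \<in> carrier G" for a
  proof -
    have "z \<otimes>\<^bsub>A_group G\<^esub> A_gen G a \<otimes>\<^bsub>A_group G\<^esub> inv\<^bsub>A_group G\<^esub> z = A_gen G a"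
      using A_gen_conj[OF z a] z1 a by simp
    then have "z \<otimes>\<^bsub>A_group G\<^esub> A_gen G a = A_gen G a \<otimes>\<^bsub>A_group G\<^esub> z"
      using A.inv_solve_right A_gen_closed[OF a] z A.m_closed by metis
    then show ?thesis using A_gen_closed[OF a] by (simp add: H_def)
  qed
  ultimately have "carrier (A_group G) \<subseteq> H"
    using presented_group_subset_subgroup unfolding A_group_def A_gen_def by blast
  then show ?thesis using assms by (auto simp: H_def)
qed

text \<open>The universal property of free abelian groups asks for a commutative target. The kernel
  provides one, whereas A(G) need not be commutative.\<close>

lemma (in group) comm_group_kernel_A_proj:
  "comm_group (A_group G\<lparr>carrier := kernel (A_group G) G (A_proj G)\<rparr>)"
proof -
  interpret \<pi>: group_hom "A_group G" G "A_proj G" by (rule A_proj_group_hom)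
  have "group (A_group G\<lparr>carrier := kernel (A_group G) G (A_proj G)\<rparr>)"
    by (rule subgroup.subgroup_is_group[OF \<pi>.subgroup_kernel group_A_group])
  then show ?thesis
    using kernel_A_proj_central by (intro group.group_comm_groupI) (auto simp: kernel_def)
qed

section \<open>Powers of generators of A(G) along a conjugacy class\<close>

lemma (in group) conj_pow:
  assumes "g \<in> carrier G" "x \<in> carrier G"
  shows "(g \<otimes> x \<otimes> inv g) [^] (n::nat) = g \<otimes> x [^] n \<otimes> inv g"
proof (induction n)
  case (Suc n)
  have "inv g \<otimes> (g \<otimes> (x \<otimes> inv g)) = x \<otimes> inv g"
    using assms by (simp add: m_assoc[symmetric])
  then show ?case using assms Suc by (simp add: m_assoc)
qed (use assms in simp)

lemma (in group) A_gen_pow_in_kernel: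
  assumes "a \<in> carrier G" "a [^] (n::nat) = \<one>"
  shows "A_gen G a [^]\<^bsub>A_group G\<^esub> n \<in> kernel (A_group G) G (A_proj G)"
proof -
  interpret \<pi>: group_hom "A_group G" G "A_proj G" by (rule A_proj_group_hom)
  show ?thesis
    using assms A_gen_closed by (simp add: kernel_def \<pi>.hom_nat_pow A_proj_gen)
qed

text \<open>The two generators are conjugate in A(G), hence so are their powers, and the power at a
  lies in the central kernel. This is why \<open>t_\<O>\<close> does not depend on the chosen
  element of a class of finite order.\<close>

lemma (in group) A_gen_pow_conj_class:
  assumes "\<O> \<in> conj_classes G" "a \<in> \<O>" "b \<in> \<O>" "a [^] (n::nat) = \<one>"
  shows "A_gen G b [^]\<^bsub>A_group G\<^esub> n = A_gen G a [^]\<^bsub>A_group G\<^esub> n"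
proof -
  interpret A: group "A_group G" by (rule group_A_group)
  have a: "a \<in> carrier G" using conj_class_closed assms(1,2) .
  obtain g where g: "g \<in> carrier G" "b = g \<otimes> a \<otimes> inv g"
    using conj_class_eq[OF assms(1,2)] assms(3) by auto
  note gc = A_gen_closed[OF g(1)] and ac = A_gen_closed[OF a]
  have "A_gen G b = A_gen G g \<otimes>\<^bsub>A_group G\<^esub> A_gen G a \<otimes>\<^bsub>A_group G\<^esub> inv\<^bsub>A_group G\<^esub> A_gen G g"
    using A_gen_conj[OF gc a] g by (simp add: A_proj_gen)
  then have "A_gen G b [^]\<^bsub>A_group G\<^esub> n =
      A_gen G g \<otimes>\<^bsub>A_group G\<^esub> A_gen G a [^]\<^bsub>A_group G\<^esub> n \<otimes>\<^bsub>A_group G\<^esub> inv\<^bsub>A_group G\<^esub> A_gen G g"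
    using A.conj_pow[OF gc ac] by simp
  also have "\<dots> = A_gen G a [^]\<^bsub>A_group G\<^esub> n"
    using kernel_A_proj_central[OF A_gen_pow_in_kernel[OF a assms(4)] gc] gc ac
    by (simp add: A.m_assoc)
  finally show ?thesis .
qed

text \<open>The exponent sum of the letters lying in \<open>\<O>\<close>. It is meaningful on A(G)
  once \<open>\<O>\<close> is closed under conjugation.\<close>

definition A_degree :: "('a, 'b) monoid_scheme \<Rightarrow> 'a set \<Rightarrow> 'a word set \<Rightarrow> int" where
  "A_degree G \<O> = pres_lift integer_group (\<lambda>a. of_bool (a \<in> \<O>))"

text \<open>A defining relation of A(G) keeps the letter b and replaces the letter a by a conjugate,
  so the count of letters in a conjugacy class is unchanged.\<close>

lemma (in group)
  assumes "\<O> \<in> conj_classes G"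
  shows A_degree_group_hom: "group_hom (A_group G) integer_group (A_degree G \<O>)"
    and A_degree_gen: "a \<in> carrier G \<Longrightarrow> A_degree G \<O> (A_gen G a) = of_bool (a \<in> \<O>)"
proof -
  interpret Z: group integer_group by simp
  let ?f = "\<lambda>a. of_bool (a \<in> \<O>) :: int"
  have f: "?f \<in> carrier G \<rightarrow> carrier integer_group" by simp
  have rel: "word_eval integer_group ?f r = word_eval integer_group ?f s"
    if rs: "(r, s) \<in> A_rels G" for r s
  proof -
    obtain a b where ab: "a \<in> carrier G" "b \<in> carrier G" "r = [(a, True), (b, True)]"
        "s = [(b, True), (inv b \<otimes> a \<otimes> b, True)]"
      using rs unfolding A_rels_def by blast
    then have "inv b \<otimes> a \<otimes> b \<in> \<O> \<longleftrightarrow> a \<in> \<O>"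
      using conj_class_conj_iff[OF assms, of a "inv b"] by simp
    then show ?thesis using ab by simp
  qed
  show "group_hom (A_group G) integer_group (A_degree G \<O>)"
    using Z.pres_lift_hom[OF f rel] group_A_group
    by (simp add: group_hom_def group_hom_axioms_def A_degree_def A_group_def)
  show "A_degree G \<O> (A_gen G a) = of_bool (a \<in> \<O>)" if "a \<in> carrier G"
    using Z.pres_lift_class[of ?f "carrier G" "A_rels G" "[(a, True)]", OF f rel] that
    by (simp add: A_degree_def A_gen_def pres_gen_def)
qed

text \<open>This reads a single coefficient off a degree. Both sides are additive in c, so agreement
  on basis elements and passage to differences suffice.\<close>

lemma hom_free_Abelian_group_integer:
  assumes "h \<in> hom (free_Abelian_group S) integer_group"
    and "\<And>y. y \<in> S \<Longrightarrow> h (frag_of y) = (if y = x then m else 0)"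
    and "c \<in> carrier (free_Abelian_group S)"
  shows "h c = m * poly_mapping.lookup c x"
proof -
  interpret h: group_hom "free_Abelian_group S" integer_group h
    using assms(1) by (simp add: group_hom_def group_hom_axioms_def)
  have "Poly_Mapping.keys c \<subseteq> S" using assms(3) by simp
  then show ?thesis
  proof (rule free_Abelian_group_induct)
    show "h 0 = m * poly_mapping.lookup 0 x" using h.hom_one by simp
  next
    fix b c :: "'a \<Rightarrow>\<^sub>0 int"
    assume *: "Poly_Mapping.keys b \<subseteq> S" "Poly_Mapping.keys c \<subseteq> S"
      "h b = m * poly_mapping.lookup b x" "h c = m * poly_mapping.lookup c x"
    have "h (b \<otimes>\<^bsub>free_Abelian_group S\<^esub> inv\<^bsub>free_Abelian_group S\<^esub> c) = h b - h c"
      using * h.hom_mult[of b "inv\<^bsub>free_Abelian_group S\<^esub> c"] h.hom_inv[of c] by simp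
    then show "h (b - c) = m * poly_mapping.lookup (b - c) x"
      using * by (simp add: lookup_minus right_diff_distrib)
  qed (use assms(2) in simp)
qed

section \<open>Consequences of a \<open>C\<close>-bar-type presentation\<close>

text \<open>A relation of the presentation is derivable, hence true of the values in G; this yields
  the equation for \<open>\<gamma> z\<close> in the conjugation case. The rule is set up for
  checking that maps on \<open>\<Gamma>\<close> respect \<open>R\<close>.\<close>

lemma (in group) cbar_presentation_rel_cases [consumes 2, case_names conj power]:
  assumes cbar: "cbar_presentation G \<Gamma> \<gamma> R" and rs: "(r, s) \<in> R"
  obtains x y z where "x \<in> \<Gamma>" "y \<in> \<Gamma>" "z \<in> \<Gamma>"
      "r = [(y, False), (x, True), (y, True)]" "s = [(z, True)]"
      "\<gamma> z = inv \<gamma> y \<otimes> \<gamma> x \<otimes> \<gamma> y"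
    | b l where "b \<in> \<Gamma>" "l \<ge> 2" "power_rel b l \<in> R" "r = replicate l (b, True)" "s = []"
proof -
  have "(\<exists>x\<in>\<Gamma>. \<exists>y\<in>\<Gamma>. \<exists>z\<in>\<Gamma>. (r, s) = conj_rel x y z) \<or>
      (\<exists>b\<in>\<Gamma>. \<exists>l\<ge>2. (r, s) = power_rel b l)"
    using cbar rs unfolding cbar_presentation_def by blast
  then consider x y z where "x \<in> \<Gamma>" "y \<in> \<Gamma>" "z \<in> \<Gamma>" "(r, s) = conj_rel x y z"
    | b l where "b \<in> \<Gamma>" "l \<ge> 2" "(r, s) = power_rel b l"
    by blast
  then show thesis
  proof cases
    case (1 x y z)
    have pres: "presents G \<Gamma> \<gamma> R" using cbar by (simp add: cbar_presentation_def)
    have rs_eq: "r = [(y, False), (x, True), (y, True)]" "s = [(z, True)]"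
      using 1 by (auto simp: conj_rel_def)
    have "([] @ r @ [], [] @ s @ []) \<in> pres_cong \<Gamma> R"
      by (rule pres_cong.rel) (use rs 1 rs_eq in auto)
    then have "word_eval G \<gamma> r = word_eval G \<gamma> s"
      using presents_cong_iff[OF pres, of r s] 1 rs_eq by simp
    moreover have "\<gamma> x \<in> carrier G" "\<gamma> y \<in> carrier G" "\<gamma> z \<in> carrier G"
      using presents_gen_closed[OF pres] 1 by auto
    ultimately have "\<gamma> z = inv \<gamma> y \<otimes> \<gamma> x \<otimes> \<gamma> y"
      using rs_eq by (simp add: m_assoc)
    then show thesis using that(1) 1(1-3) rs_eq by blast
  next
    case (2 b l)
    then show thesis using that(2) rs by (simp add: power_rel_def)
  qed
qed

text \<open>Since conjugate generators carry at most one power relation, sending the generators in one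
  conjugacy class to \<open>1\<close> and all others to \<open>0\<close> respects the relations modulo the exponent \<open>k\<close> of
  that power relation. Hence the order is not a proper divisor of \<open>k\<close>.\<close>

lemma (in group) ord_power_rel:
  assumes cbar: "cbar_presentation G \<Gamma> \<gamma> R"
    and a: "a \<in> \<Gamma>" and k: "k \<ge> 2" and pow: "power_rel a k \<in> R"
  shows "ord (\<gamma> a) = k"
proof -
  have pres: "presents G \<Gamma> \<gamma> R" using cbar by (simp add: cbar_presentation_def)
  note \<gamma> = presents_gen_closed[OF pres] and cong = presents_cong_iff[OF pres]
  have \<gamma>a: "\<gamma> a \<in> carrier G" using \<gamma> a by auto
  obtain \<O> where \<O>: "\<O> \<in> conj_classes G" "\<gamma> a \<in> \<O>"
    using conj_class_exists[OF \<gamma>a] .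
  interpret Z: group "integer_mod_group k" by simp
  let ?f = "\<lambda>x. of_bool (\<gamma> x \<in> \<O>) :: int"
  \<comment> \<open>The carrier consists of the residues below k, so \<open>k \<ge> 2\<close> is
    what admits the value 1.\<close>
  have f: "?f \<in> \<Gamma> \<rightarrow> carrier (integer_mod_group k)"
    using k by (auto simp: carrier_integer_mod_group)
  have rel: "word_eval (integer_mod_group k) ?f r = word_eval (integer_mod_group k) ?f s"
    if rs: "(r, s) \<in> R" for r s
  proof -
    from cbar rs show ?thesis
    proof (cases rule: cbar_presentation_rel_cases)
      case (conj x y z)
      have g: "\<gamma> x \<in> carrier G" "\<gamma> y \<in> carrier G" "\<gamma> z \<in> carrier G" using \<gamma> conj by auto
      have "\<gamma> z \<in> \<O> \<longleftrightarrow> \<gamma> x \<in> \<O>"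
        using conj_class_conj_iff[OF \<O>(1), of "\<gamma> x" "inv \<gamma> y"] g conj by simp
      moreover have "?f y \<in> carrier (integer_mod_group k)" using f conj by blast
      ultimately show ?thesis using conj(4,5) k
        by (simp add: mod_simps split: if_splits)
    next
      case (power b l)
      have fb: "?f b \<in> carrier (integer_mod_group k)" using f power by blast
      \<comment> \<open>Only generators in \<open>\<O>\<close> matter, and there the uniqueness of
        the power relation forces l = k.\<close>
      have "int l * ?f b mod int k = 0"
      proof (cases "\<gamma> b \<in> \<O>")
        case True
        then have "power_rel b l = power_rel a k"
          using cbar power a k pow \<O> unfolding cbar_presentation_def by metis
        then have "l = k" by (metis power_rel_def prod.inject length_replicate)
        then show ?thesis by simp
      qed simp
      then show ?thesis using Z.word_eval_replicate[of ?f b l] fb power(4,5) by simp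
    qed
  qed
  have "\<gamma> a [^] n = \<one> \<longleftrightarrow> k dvd n" for n
  proof
    assume n: "\<gamma> a [^] n = \<one>"
    \<comment> \<open>An equation between values in G is derivable from \<open>R\<close>, so it
      survives in the integers modulo k, where the n-th power of the image of a is n.\<close>
    then have "(replicate n (a, True), []) \<in> pres_cong \<Gamma> R"
      using cong[of "replicate n (a, True)" "[]"] word_eval_replicate[of \<gamma> a, OF \<gamma>a] words_replicate[OF a]
      by simp
    from Z.word_eval_cong[OF this f rel]
    have "word_eval (integer_mod_group k) ?f (replicate n (a, True)) = 0" by simp
    moreover have "?f a \<in> carrier (integer_mod_group k)" using f a by blast
    ultimately have "int n mod int k = 0"
      using Z.word_eval_replicate[of ?f a n] \<O>(2) by simp
    then show "k dvd n" by (simp add: mod_eq_0_iff_dvd)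
  next
    assume "k dvd n"
    have "([] @ replicate k (a, True) @ [], [] @ [] @ []) \<in> pres_cong \<Gamma> R"
      by (rule pres_cong.rel) (use pow words_replicate[OF a] in \<open>auto simp: power_rel_def\<close>)
    then have "\<gamma> a [^] k = \<one>"
      using cong[of "replicate k (a, True)" "[]"] word_eval_replicate[of \<gamma> a, OF \<gamma>a] words_replicate[OF a]
      by simp
    then show "\<gamma> a [^] n = \<one>"
      using \<open>k dvd n\<close> pow_eq_id[OF \<gamma>a] dvd_trans by blast
  qed
  then show ?thesis using ord_unique[OF \<gamma>a] by blast
qed

text \<open>The cosets of the \<open>A_gen G (\<gamma> x)\<close> satisfy every relation in
  \<open>R\<close>: the conjugation relations already hold in A(G), and the power relations hold
  modulo N. A word that is trivial in G is derivably empty, so its value in the quotient is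
  trivial.\<close>

lemma (in group) A_word_in_subgroup:
  assumes cbar: "cbar_presentation G \<Gamma> \<gamma> R"
    and N: "N \<lhd> A_group G"
    and pow: "\<And>x. \<lbrakk>x \<in> \<Gamma>; ord (\<gamma> x) \<noteq> 0\<rbrakk> \<Longrightarrow> A_gen G (\<gamma> x) [^]\<^bsub>A_group G\<^esub> ord (\<gamma> x) \<in> N"
    and w: "w \<in> words \<Gamma>" and w1: "word_eval G \<gamma> w = \<one>"
  shows "word_eval (A_group G) (\<lambda>x. A_gen G (\<gamma> x)) w \<in> N"
proof -
  have pres: "presents G \<Gamma> \<gamma> R" using cbar by (simp add: cbar_presentation_def)
  note \<gamma> = presents_gen_closed[OF pres] and cong = presents_cong_iff[OF pres]
  interpret A: group "A_group G" by (rule group_A_group)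
  interpret N: normal N "A_group G" by (rule N)
  interpret Q: group "A_group G Mod N" by (rule N.factorgroup_is_group)
  interpret q: group_hom "A_group G" "A_group G Mod N" "\<lambda>y. N #>\<^bsub>A_group G\<^esub> y"
    using N.r_coset_hom_Mod A.is_group Q.is_group by (simp add: group_hom_def group_hom_axioms_def)
  let ?e = "\<lambda>x. A_gen G (\<gamma> x)" and ?f = "\<lambda>x. N #>\<^bsub>A_group G\<^esub> A_gen G (\<gamma> x)"
  have e: "?e \<in> \<Gamma> \<rightarrow> carrier (A_group G)" using \<gamma> A_gen_closed by blast
  then have f: "?f \<in> \<Gamma> \<rightarrow> carrier (A_group G Mod N)" using q.hom_closed by blast
  have ev: "word_eval (A_group G Mod N) ?f u = N #>\<^bsub>A_group G\<^esub> word_eval (A_group G) ?e u"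
    if "u \<in> words \<Gamma>" for u
    using q.hom_word_eval[OF e _ that, of ?f] by simp
  have rel: "word_eval (A_group G Mod N) ?f r = word_eval (A_group G Mod N) ?f s"
    if rs: "(r, s) \<in> R" for r s
  proof -
    from cbar rs show ?thesis
    proof (cases rule: cbar_presentation_rel_cases)
      case (conj x y z)
      have g: "\<gamma> x \<in> carrier G" "\<gamma> y \<in> carrier G" "\<gamma> z \<in> carrier G" using \<gamma> conj by auto
      have "?e x \<otimes>\<^bsub>A_group G\<^esub> ?e y = ?e y \<otimes>\<^bsub>A_group G\<^esub> ?e z"
        using A_gen_rel[OF g(1,2)] conj(6) by simp
      then have "word_eval (A_group G) ?e r = word_eval (A_group G) ?e s"
        using g[THEN A_gen_closed] conj(4,5) by (simp add: A.m_assoc[symmetric])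
      then show ?thesis using ev[of r] ev[of s] conj by simp
    next
      case (power b l)
      \<comment> \<open>The hypothesis \<open>pow\<close> speaks of orders and the relation of its
        exponent; \<open>ord_power_rel\<close> identifies the two.\<close>
      have "ord (\<gamma> b) = l" using ord_power_rel[OF cbar power(1-3)] .
      then have "?e b [^]\<^bsub>A_group G\<^esub> l \<in> N" using pow[OF power(1)] power(2) by auto
      moreover have eb: "?e b \<in> carrier (A_group G)" using e power(1) by blast
      ultimately have "N #>\<^bsub>A_group G\<^esub> (?e b [^]\<^bsub>A_group G\<^esub> l) = N"
        by (intro A.coset_join2 N.subgroup_axioms) auto
      then show ?thesis
        using ev[of r] power(4,5) words_replicate[OF power(1)] A.word_eval_replicate[of ?e b l] eb by simp
    qed
  qed
  have "(w, []) \<in> pres_cong \<Gamma> R" using cong[of w "[]"] w w1 by simp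
  then have "word_eval (A_group G Mod N) ?f w = word_eval (A_group G Mod N) ?f []"
    using Q.word_eval_cong[OF _ f rel] by blast
  then have "N #>\<^bsub>A_group G\<^esub> word_eval (A_group G) ?e w = N"
    using ev[OF w] by simp
  then show ?thesis
    using A.coset_join1 A.word_eval_closed[OF e w] N.subgroup_axioms by blast
qed

text \<open>Let E be generated by the \<open>A_gen G (\<gamma> x)\<close>. The hypotheses on N give
  NE = A(G), so a kernel element is some n in N times the value of a word over
  \<open>\<Gamma>\<close>. That word is trivial in G, and its value lies in N by
  \<open>A_word_in_subgroup\<close>.\<close>

lemma (in group) kernel_A_proj_subset:
  assumes cbar: "cbar_presentation G \<Gamma> \<gamma> R"
    and N: "subgroup N (A_group G)" and N_ker: "N \<subseteq> kernel (A_group G) G (A_proj G)"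
    and pow: "\<And>x. \<lbrakk>x \<in> \<Gamma>; ord (\<gamma> x) \<noteq> 0\<rbrakk> \<Longrightarrow> A_gen G (\<gamma> x) [^]\<^bsub>A_group G\<^esub> ord (\<gamma> x) \<in> N"
    and ng: "\<And>\<O>. \<O> \<in> conj_classes_ng G (\<gamma> ` \<Gamma>) \<Longrightarrow> \<exists>a\<in>\<O>. \<exists>w\<in>words \<Gamma>. t_ng G \<gamma> a w \<in> N"
  shows "kernel (A_group G) G (A_proj G) \<subseteq> N"
proof -
  have pres: "presents G \<Gamma> \<gamma> R" using cbar by (simp add: cbar_presentation_def)
  note \<gamma> = presents_gen_closed[OF pres] and surj = presents_word_eval_surj[OF pres]
  interpret A: group "A_group G" by (rule group_A_group)
  interpret \<pi>: group_hom "A_group G" G "A_proj G" by (rule A_proj_group_hom)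
  interpret N: subgroup N "A_group G" by (rule N)
  let ?e = "\<lambda>x. A_gen G (\<gamma> x)"
  have e: "?e \<in> \<Gamma> \<rightarrow> carrier (A_group G)" using \<gamma> A_gen_closed by blast
  define E where "E = word_eval (A_group G) ?e ` words \<Gamma>"
  have E: "subgroup E (A_group G)" unfolding E_def by (rule A.subgroup_word_evals[OF e])
  interpret E: subgroup E "A_group G" by (rule E)
  have \<pi>_eval: "A_proj G (word_eval (A_group G) ?e w) = word_eval G \<gamma> w" if "w \<in> words \<Gamma>" for w
    using \<pi>.hom_word_eval[OF e _ that, of \<gamma>] \<gamma> A_proj_gen by blast
  have N_normal: "N \<lhd> A_group G"
  proof (rule A.normal_invI[OF N])
    fix x h assume x: "x \<in> carrier (A_group G)" and h: "h \<in> N"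
    then have "x \<otimes>\<^bsub>A_group G\<^esub> h = h \<otimes>\<^bsub>A_group G\<^esub> x"
      using kernel_A_proj_central N_ker by blast
    then show "x \<otimes>\<^bsub>A_group G\<^esub> h \<otimes>\<^bsub>A_group G\<^esub> inv\<^bsub>A_group G\<^esub> x \<in> N"
      using x h by (simp add: A.m_assoc)
  qed
  \<comment> \<open>This locale is wanted for the fact that the product of a normal subgroup and a
    subgroup is a subgroup.\<close>
  interpret NE: second_isomorphism_grp N "A_group G" E
    using N_normal E by (simp add: second_isomorphism_grp_def second_isomorphism_grp_axioms_def)
  define M where "M = N <#>\<^bsub>A_group G\<^esub> E"
  have M: "subgroup M (A_group G)"
    unfolding M_def by (rule NE.normal_set_mult_subgroup)
  interpret M: subgroup M "A_group G" by (rule M)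
  have E_M: "y \<in> M" if "y \<in> E" for y
  proof -
    have "\<one>\<^bsub>A_group G\<^esub> \<otimes>\<^bsub>A_group G\<^esub> y \<in> M"
      using that N.one_closed unfolding M_def set_mult_def by blast
    then show ?thesis using that by simp
  qed
  have N_M: "y \<in> M" if "y \<in> N" for y
  proof -
    have "y \<otimes>\<^bsub>A_group G\<^esub> \<one>\<^bsub>A_group G\<^esub> \<in> M"
      using that E.one_closed unfolding M_def set_mult_def by blast
    then show ?thesis using that by simp
  qed
  have "A_gen G b \<in> M" if b: "b \<in> carrier G" for b
  proof -
    obtain \<O> where \<O>: "\<O> \<in> conj_classes G" "b \<in> \<O>" using conj_class_exists[OF b] .
    \<comment> \<open>One element per class is enough. It is either the value of a generator or the
      element for which \<open>ng\<close> supplies \<open>t_ng\<close>, and \<open>t_ng\<close>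
      differs from \<open>A_gen G a\<close> by a factor in E.\<close>
    have "\<exists>a\<in>\<O>. A_gen G a \<in> M"
    proof (cases "\<O> \<inter> \<gamma> ` \<Gamma> = {}")
      case True
      then obtain a w where aw: "a \<in> \<O>" "w \<in> words \<Gamma>" "t_ng G \<gamma> a w \<in> N"
        using ng[of \<O>] \<O> by (auto simp: conj_classes_ng_def)
      let ?v = "word_eval (A_group G) ?e (word_inv w)"
      have v: "?v \<in> E" using aw(2) word_inv_words unfolding E_def by blast
      have ac: "A_gen G a \<in> carrier (A_group G)"
        using A_gen_closed conj_class_closed[OF \<O>(1) aw(1)] .
      have "A_gen G a = t_ng G \<gamma> a w \<otimes>\<^bsub>A_group G\<^esub> inv\<^bsub>A_group G\<^esub> ?v"
        unfolding t_ng_def using ac v by (simp add: A.m_assoc)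
      moreover have "\<dots> \<in> M" using v aw(3) E_M N_M by blast
      ultimately show ?thesis using aw(1) by (metis (no_types))
    next
      case False
      then obtain x where x: "x \<in> \<Gamma>" "\<gamma> x \<in> \<O>" by auto
      have "word_eval (A_group G) ?e [(x, True)] \<in> E"
        unfolding E_def by (rule imageI) (use x(1) in simp)
      moreover have "?e x \<in> carrier (A_group G)" using e x(1) by blast
      ultimately have "?e x \<in> E" by simp
      then show ?thesis using x(2) E_M by blast
    qed
    then obtain a where a: "a \<in> \<O>" "A_gen G a \<in> M" by blast
    obtain g where g: "g \<in> carrier G" "b = g \<otimes> a \<otimes> inv g"
      using conj_class_eq[OF \<O>(1) a(1)] \<O>(2) by auto
    \<comment> \<open>Since \<open>\<Gamma>\<close> generates G, the conjugating element g lifts to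
      an element of E, and by \<open>A_gen_conj\<close> conjugation by this lift takes
      \<open>A_gen G a\<close> to \<open>A_gen G b\<close>.\<close>
    obtain w where w: "w \<in> words \<Gamma>" "g = word_eval G \<gamma> w" using surj g(1) by auto
    let ?y = "word_eval (A_group G) ?e w"
    have y: "?y \<in> M" using E_M w(1) by (simp add: E_def)
    have "A_gen G b =
        ?y \<otimes>\<^bsub>A_group G\<^esub> A_gen G a \<otimes>\<^bsub>A_group G\<^esub> inv\<^bsub>A_group G\<^esub> ?y"
      using A_gen_conj[of ?y a] conj_class_closed[OF \<O>(1) a(1)] A.word_eval_closed[OF e w(1)]
        \<pi>_eval[OF w(1)] w(2) g(2) by simp
    then show ?thesis using y a(2) by simp
  qed
  then have "carrier (A_group G) \<subseteq> M"
    using presented_group_subset_subgroup M unfolding A_group_def A_gen_def by blast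
  show ?thesis
  proof
    fix z assume z: "z \<in> kernel (A_group G) G (A_proj G)"
    then have "z \<in> M" using \<open>carrier (A_group G) \<subseteq> M\<close> by (auto simp: kernel_def)
    then obtain n w where nw: "n \<in> N" "w \<in> words \<Gamma>"
        "z = n \<otimes>\<^bsub>A_group G\<^esub> word_eval (A_group G) ?e w"
      by (auto simp: M_def E_def set_mult_def)
    have "A_proj G n = \<one>" using N_ker nw(1) by (auto simp: kernel_def)
    then have "word_eval G \<gamma> w = \<one>"
      using z nw(1,3) \<pi>_eval[OF nw(2)] A.word_eval_closed[OF e nw(2)] word_eval_closed[OF \<gamma> nw(2)]
      by (simp add: kernel_def)
    then have "word_eval (A_group G) ?e w \<in> N"
      using A_word_in_subgroup[OF cbar N_normal pow nw(2)] by blast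
    then show "z \<in> N" using nw by simp
  qed
qed

section \<open>The elements attached to classes without generators\<close>

lemma (in group) t_ng_in_kernel:
  assumes "\<gamma> \<in> \<Gamma> \<rightarrow> carrier G" "w \<in> words \<Gamma>" "a = word_eval G \<gamma> w"
  shows "t_ng G \<gamma> a w \<in> kernel (A_group G) G (A_proj G)"
proof -
  interpret \<pi>: group_hom "A_group G" G "A_proj G" by (rule A_proj_group_hom)
  let ?e = "\<lambda>x. A_gen G (\<gamma> x)"
  have e: "?e \<in> \<Gamma> \<rightarrow> carrier (A_group G)" using assms(1) A_gen_closed by blast
  have a: "a \<in> carrier G" using assms word_eval_closed by blast
  have "A_proj G (word_eval (A_group G) ?e (word_inv w)) = word_eval G \<gamma> (word_inv w)"
    using \<pi>.hom_word_eval[OF e _ word_inv_words[OF assms(2)], of \<gamma>] assms(1) A_proj_gen by blast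
  also have "\<dots> = inv a"
    using word_eval_word_inv[OF assms(1,2)] assms(3) by simp
  finally show ?thesis
    using A_gen_closed[OF a] \<pi>.G.word_eval_closed[OF e word_inv_words[OF assms(2)]] a
    by (simp add: t_ng_def kernel_def A_proj_gen)
qed

lemma (in group) A_degree_t_ng:
  assumes "\<gamma> \<in> \<Gamma> \<rightarrow> carrier G" "w \<in> words \<Gamma>" "a \<in> carrier G"
    and "\<O> \<in> conj_classes_ng G (\<gamma> ` \<Gamma>)"
  shows "A_degree G \<O> (t_ng G \<gamma> a w) = of_bool (a \<in> \<O>)"
proof -
  have \<O>: "\<O> \<in> conj_classes G" "\<And>x. x \<in> \<Gamma> \<Longrightarrow> \<gamma> x \<notin> \<O>"
    using assms(4) by (auto simp: conj_classes_ng_def)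
  interpret d: group_hom "A_group G" integer_group "A_degree G \<O>"
    by (rule A_degree_group_hom[OF \<O>(1)])
  let ?e = "\<lambda>x. A_gen G (\<gamma> x)"
  have e: "?e \<in> \<Gamma> \<rightarrow> carrier (A_group G)" using assms(1) A_gen_closed by blast
  have zero: "word_eval integer_group (\<lambda>_. 0) u = 0" for u :: "'d word"
    by (induction u) auto
  have "A_degree G \<O> (word_eval (A_group G) ?e (word_inv w)) =
      word_eval integer_group (\<lambda>_. 0) (word_inv w)"
    by (rule d.hom_word_eval[OF e _ word_inv_words[OF assms(2)]])
      (use \<O> A_degree_gen[OF \<O>(1)] funcset_mem[OF assms(1)] in simp)
  then show ?thesis
    using A_gen_closed[OF assms(3)] d.G.word_eval_closed[OF e word_inv_words[OF assms(2)]]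
    by (simp add: t_ng_def zero A_degree_gen[OF \<O>(1) assms(3)])
qed

text \<open>Infinite order is covered as well: \<open>class_order\<close> is then 0.\<close>

lemma (in group) class_order_pow:
  "\<O> \<in> conj_classes G \<Longrightarrow> a \<in> \<O> \<Longrightarrow> a [^] class_order G \<O> = \<one>"
  using conj_class_closed by (simp add: class_order_eq)

theorem proposition5p3:
  fixes G :: "('a, 'b) monoid_scheme"
    and \<Gamma> :: "'g set" and \<gamma> :: "'g \<Rightarrow> 'a"
    and R :: "('g word \<times> 'g word) set"
    and rep :: "'a set \<Rightarrow> 'a" and expr :: "'a set \<Rightarrow> 'g word"
  assumes "group G"
    and "cbar_presentation G \<Gamma> \<gamma> R"
    and "\<And>\<O>. \<O> \<in> conj_classes_ng G (\<gamma> ` \<Gamma>) \<Longrightarrow>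
           rep \<O> \<in> \<O> \<and> expr \<O> \<in> words \<Gamma> \<and> rep \<O> = word_eval G \<gamma> (expr \<O>)"
  shows "\<exists>\<iota>.
     short_exact
       (free_Abelian_group (conj_classes_ng G (\<gamma> ` \<Gamma>)) \<times>\<times> free_Abelian_group (conj_classes_fg G (\<gamma> ` \<Gamma>)))
       (A_group G) G \<iota> (A_proj G) \<and>
     (\<forall>\<O> \<in> conj_classes_ng G (\<gamma> ` \<Gamma>).
        \<iota> (frag_of \<O>, 0) = t_ng G \<gamma> (rep \<O>) (expr \<O>)) \<and>
     (\<forall>\<O> \<in> conj_classes_fg G (\<gamma> ` \<Gamma>). \<forall>a\<in>\<O>.
        \<iota> (0, frag_of \<O>) = A_gen G a [^]\<^bsub>A_group G\<^esub> class_order G \<O>)"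
proof -
  interpret G: group G by (rule assms(1))
  interpret A: group "A_group G" by (rule G.group_A_group)
  interpret \<pi>: group_hom "A_group G" G "A_proj G" by (rule G.A_proj_group_hom)
  have pres: "presents G \<Gamma> \<gamma> R" using assms(2) by (simp add: cbar_presentation_def)
  note \<gamma> = G.presents_gen_closed[OF pres]
  define NG where "NG = conj_classes_ng G (\<gamma> ` \<Gamma>)"
  define FG where "FG = conj_classes_fg G (\<gamma> ` \<Gamma>)"
  define K where "K = kernel (A_group G) G (A_proj G)"
  have NG_conj: "\<O> \<in> conj_classes G" if "\<O> \<in> NG" for \<O>
    using that by (simp add: NG_def conj_classes_ng_def)
  have FG_conj: "\<O> \<in> conj_classes G" "\<O> \<notin> NG" if "\<O> \<in> FG" for \<O>
    using that by (auto simp: NG_def FG_def conj_classes_ng_def conj_classes_fg_def)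
  note rep = assms(3)[folded NG_def]
  define s where "s \<O> = t_ng G \<gamma> (rep \<O>) (expr \<O>)" for \<O>
  \<comment> \<open>The choice is harmless: by the next fact every element of a class in
    \<open>FG\<close> gives the same power.\<close>
  define t where "t \<O> = A_gen G (SOME a. a \<in> \<O>) [^]\<^bsub>A_group G\<^esub> class_order G \<O>" for \<O>
  have t: "t \<O> = A_gen G a [^]\<^bsub>A_group G\<^esub> class_order G \<O>" if "\<O> \<in> FG" "a \<in> \<O>" for \<O> a
    unfolding t_def using that FG_conj G.class_order_pow
    by (intro G.A_gen_pow_conj_class[of \<O>]) (auto intro: someI)
  have s_K: "s ` NG \<subseteq> K"
    unfolding s_def K_def using rep G.t_ng_in_kernel[OF \<gamma>] by blast
  have t_K: "t ` FG \<subseteq> K"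
  proof
    fix y assume "y \<in> t ` FG"
    then obtain \<O> where \<O>: "\<O> \<in> FG" "y = t \<O>" by auto
    obtain a where a: "a \<in> \<O>" using \<O>(1) by (auto simp: FG_def conj_classes_fg_def)
    then show "y \<in> K"
      using t[OF \<O>(1) a] \<O>(2) G.A_gen_pow_in_kernel[of a] G.class_order_pow[OF FG_conj(1)[OF \<O>(1)] a]
        G.conj_class_closed[OF FG_conj(1)[OF \<O>(1)] a] by (simp add: K_def)
  qed

  \<comment> \<open>Construction of \<open>\<iota>\<close> from the universal property\<close>
  interpret C: comm_group "A_group G\<lparr>carrier := K\<rparr>"
    unfolding K_def by (rule G.comm_group_kernel_A_proj)
  obtain h where h_hom: "h \<in> hom (free_Abelian_group NG) (A_group G\<lparr>carrier := K\<rparr>)"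
    and h: "\<And>\<O>. \<O> \<in> NG \<Longrightarrow> h (frag_of \<O>) = s \<O>"
    using C.free_Abelian_group_universal[of s NG] s_K by auto
  obtain k where k_hom: "k \<in> hom (free_Abelian_group FG) (A_group G\<lparr>carrier := K\<rparr>)"
    and k: "\<And>\<O>. \<O> \<in> FG \<Longrightarrow> k (frag_of \<O>) = t \<O>"
    using C.free_Abelian_group_universal[of t FG] t_K by auto
  have K_A: "y \<in> carrier (A_group G)" if "y \<in> K" for y
    using that by (simp add: K_def kernel_def)
  have h_A: "group_hom (free_Abelian_group NG) (A_group G) h"
    and k_A: "group_hom (free_Abelian_group FG) (A_group G) k"
    using h_hom k_hom K_A A.is_group
    by (auto simp: group_hom_def group_hom_axioms_def hom_def Pi_iff)
  interpret h: group_hom "free_Abelian_group NG" "A_group G" h by (rule h_A)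
  interpret k: group_hom "free_Abelian_group FG" "A_group G" k by (rule k_A)
  have h_K: "h p \<in> K" if "p \<in> carrier (free_Abelian_group NG)" for p
    using h_hom that by (auto simp: hom_def)
  have k_K: "k q \<in> K" if "q \<in> carrier (free_Abelian_group FG)" for q
    using k_hom that by (auto simp: hom_def)

  define F where "F = free_Abelian_group NG \<times>\<times> free_Abelian_group FG"
  define \<iota> where "\<iota> = (\<lambda>(p, q). h p \<otimes>\<^bsub>A_group G\<^esub> k q)"
  have "\<iota> \<in> hom F (A_group G)"
  proof (rule homI)
    fix x assume "x \<in> carrier F"
    then show "\<iota> x \<in> carrier (A_group G)" by (auto simp: F_def \<iota>_def)
  next
    fix x y assume "x \<in> carrier F" "y \<in> carrier F"
    then obtain p q p' q' where xy: "x = (p, q)" "y = (p', q')"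
        "p \<in> carrier (free_Abelian_group NG)" "p' \<in> carrier (free_Abelian_group NG)"
        "q \<in> carrier (free_Abelian_group FG)" "q' \<in> carrier (free_Abelian_group FG)"
      unfolding F_def carrier_DirProd by blast
    \<comment> \<open>The two middle factors of a product of values of \<open>\<iota>\<close> must
      change places; centrality of the kernel permits it.\<close>
    have "h p' \<otimes>\<^bsub>A_group G\<^esub> k q = k q \<otimes>\<^bsub>A_group G\<^esub> h p'"
      using G.kernel_A_proj_central[of "k q" "h p'"] k_K xy by (simp add: K_def)
    then have "h p' \<otimes>\<^bsub>A_group G\<^esub> (k q \<otimes>\<^bsub>A_group G\<^esub> k q') = k q \<otimes>\<^bsub>A_group G\<^esub> (h p' \<otimes>\<^bsub>A_group G\<^esub> k q')"
      using xy h.hom_closed k.hom_closed by (simp add: A.m_assoc[symmetric])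
    moreover have "h (p + p') = h p \<otimes>\<^bsub>A_group G\<^esub> h p'" "k (q + q') = k q \<otimes>\<^bsub>A_group G\<^esub> k q'"
      using h.hom_mult[of p p'] k.hom_mult[of q q'] xy by simp_all
    ultimately show "\<iota> (x \<otimes>\<^bsub>F\<^esub> y) = \<iota> x \<otimes>\<^bsub>A_group G\<^esub> \<iota> y"
      using xy h.hom_closed k.hom_closed by (simp add: F_def \<iota>_def A.m_assoc)
  qed
  then have \<iota>_hom: "group_hom F (A_group G) \<iota>"
    by (simp add: group_hom_def group_hom_axioms_def A.is_group F_def DirProd_group)
  interpret \<iota>: group_hom F "A_group G" \<iota> by (rule \<iota>_hom)
  have K_sub: "subgroup K (A_group G)" unfolding K_def by (rule \<pi>.subgroup_kernel)

  have \<iota>_ng: "\<iota> (frag_of \<O>, 0) = s \<O>" if "\<O> \<in> NG" for \<O>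
    using that k.hom_one h[OF that] h.hom_closed[of "frag_of \<O>"] by (simp add: \<iota>_def)
  have \<iota>_fg: "\<iota> (0, frag_of \<O>) = t \<O>" if "\<O> \<in> FG" for \<O>
    using that h.hom_one k[OF that] k.hom_closed[of "frag_of \<O>"] by (simp add: \<iota>_def)

  \<comment> \<open>Injectivity of \<open>\<iota>\<close> by degrees\<close>
  have "inj_on \<iota> (carrier F)"
    unfolding \<iota>.inj_on_one_iff
  proof (intro allI impI)
    fix x assume "x \<in> carrier F" and one: "\<iota> x = \<one>\<^bsub>A_group G\<^esub>"
    then obtain p q where x: "x = (p, q)" "p \<in> carrier (free_Abelian_group NG)"
        "q \<in> carrier (free_Abelian_group FG)"
      unfolding F_def carrier_DirProd by blast
    \<comment> \<open>Each class turns \<open>\<iota> x = \<one>\<close> into one integer equation.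
      The last fact holds for any class \<open>\<O>\<close>, in \<open>FG\<close> or not.\<close>
    have degree: "A_degree G \<O> (h p) + A_degree G \<O> (k q) = 0"
        "(\<lambda>p. A_degree G \<O> (h p)) \<in> hom (free_Abelian_group NG) integer_group"
        "(\<lambda>q. A_degree G \<O> (k q)) \<in> hom (free_Abelian_group FG) integer_group"
        "\<And>\<O>'. \<O>' \<in> FG \<Longrightarrow> A_degree G \<O> (k (frag_of \<O>')) =
           (if \<O>' = \<O> then int (class_order G \<O>) else 0)"
      if \<O>: "\<O> \<in> conj_classes G" for \<O>
    proof -
      interpret d: group_hom "A_group G" integer_group "A_degree G \<O>"
        by (rule G.A_degree_group_hom[OF \<O>])
      show "A_degree G \<O> (h p) + A_degree G \<O> (k q) = 0"
        using one x d.hom_mult[of "h p" "k q"] d.hom_one h.hom_closed[of p] k.hom_closed[of q]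
        by (simp add: \<iota>_def)
      show "(\<lambda>p. A_degree G \<O> (h p)) \<in> hom (free_Abelian_group NG) integer_group"
        using hom_compose[OF h.homh d.homh] by (simp add: comp_def)
      show "(\<lambda>q. A_degree G \<O> (k q)) \<in> hom (free_Abelian_group FG) integer_group"
        using hom_compose[OF k.homh d.homh] by (simp add: comp_def)
      fix \<O>' assume \<O>': "\<O>' \<in> FG"
      obtain a where a: "a \<in> \<O>'" using \<O>' by (auto simp: FG_def conj_classes_fg_def)
      have ac: "a \<in> carrier G" using G.conj_class_closed[OF FG_conj(1)[OF \<O>'] a] .
      have "A_degree G \<O> (k (frag_of \<O>')) = int (class_order G \<O>') * of_bool (a \<in> \<O>)"
        using k[OF \<O>'] t[OF \<O>' a] d.hom_nat_pow[OF G.A_gen_closed[OF ac]]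
          G.A_degree_gen[OF \<O> ac] by simp
      moreover have "a \<in> \<O> \<longleftrightarrow> \<O>' = \<O>"
        using G.conj_class_unique[OF \<O> FG_conj(1)[OF \<O>']] a by blast
      ultimately show "A_degree G \<O> (k (frag_of \<O>')) =
          (if \<O>' = \<O> then int (class_order G \<O>) else 0)" by simp
    qed
    \<comment> \<open>The coefficients over \<open>NG\<close> come first: degrees at these classes
      vanish on every \<open>t \<O>'\<close>, whereas the elements \<open>s \<O>'\<close> may have
      nonzero degree at classes in \<open>FG\<close>.\<close>
    have "poly_mapping.lookup p \<O> = 0" for \<O>
    proof (cases "\<O> \<in> NG")
      case True
      have "A_degree G \<O> (h (frag_of \<O>')) = (if \<O>' = \<O> then 1 else 0)" if \<O>': "\<O>' \<in> NG" for \<O>'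
      proof -
        have r: "rep \<O>' \<in> \<O>'" "expr \<O>' \<in> words \<Gamma>" using rep[OF \<O>'] by auto
        have "A_degree G \<O> (h (frag_of \<O>')) = of_bool (rep \<O>' \<in> \<O>)"
          using G.A_degree_t_ng[OF \<gamma> r(2) _ True[unfolded NG_def]] h[OF \<O>']
            G.conj_class_closed[OF NG_conj[OF \<O>'] r(1)] by (simp add: s_def)
        moreover have "rep \<O>' \<in> \<O> \<longleftrightarrow> \<O>' = \<O>"
          using G.conj_class_unique[OF NG_conj[OF True] NG_conj[OF \<O>']] r(1) by blast
        ultimately show ?thesis by simp
      qed
      then have "A_degree G \<O> (h p) = 1 * poly_mapping.lookup p \<O>"
        using hom_free_Abelian_group_integer[OF degree(2)[OF NG_conj[OF True]] _ x(2)] by blast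
      moreover have "A_degree G \<O> (k q) = 0 * poly_mapping.lookup q \<O>"
        by (rule hom_free_Abelian_group_integer[OF degree(3)[OF NG_conj[OF True]] _ x(3)])
          (use degree(4)[OF NG_conj[OF True]] FG_conj(2) True in auto)
      ultimately show ?thesis using degree(1)[OF NG_conj[OF True]] by simp
    next
      case False
      then show ?thesis using x(2) by (auto simp: in_keys_iff)
    qed
    then have p: "p = 0" by (intro poly_mapping_eqI) simp
    have "poly_mapping.lookup q \<O> = 0" for \<O>
    proof (cases "\<O> \<in> FG")
      case True
      note \<O> = FG_conj(1)[OF True]
      have "A_degree G \<O> (k q) = int (class_order G \<O>) * poly_mapping.lookup q \<O>"
        using hom_free_Abelian_group_integer[OF degree(3)[OF \<O>] _ x(3)] degree(4)[OF \<O>] by blast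
      moreover have "A_degree G \<O> (h p) = 0"
        using p h.hom_one group_hom.hom_one[OF G.A_degree_group_hom[OF \<O>]] by simp
      \<comment> \<open>Finite order enters here: it makes the diagonal entry nonzero, and the
        coefficient can be cancelled to 0.\<close>
      moreover have "class_order G \<O> \<noteq> 0"
      proof -
        obtain a n where a: "a \<in> \<O>" "n > 0" "a [^]\<^bsub>G\<^esub> (n::nat) = \<one>\<^bsub>G\<^esub>"
          using True unfolding FG_def conj_classes_fg_def by blast
        then show ?thesis
          using G.class_order_eq[OF \<O> a(1)] G.pow_eq_id[OF G.conj_class_closed[OF \<O> a(1)]] by auto
      qed
      ultimately show ?thesis using degree(1)[OF \<O>] by simp
    next
      case False
      then show ?thesis using x(3) by (auto simp: in_keys_iff)
    qed
    then have "q = 0" by (intro poly_mapping_eqI) simp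
    with p show "x = \<one>\<^bsub>F\<^esub>" using x(1) by (simp add: F_def)
  qed

  \<comment> \<open>Exactness at A(G)\<close>
  moreover have "\<iota> ` carrier F = K"
  proof
    show im: "\<iota> ` carrier F \<subseteq> K"
      using h_K k_K subgroup.m_closed[OF K_sub] by (auto simp: F_def \<iota>_def)
    show "K \<subseteq> \<iota> ` carrier F"
      unfolding K_def
    proof (rule G.kernel_A_proj_subset[OF assms(2) \<iota>.img_is_subgroup im[unfolded K_def]])
      fix x assume x: "x \<in> \<Gamma>" "G.ord (\<gamma> x) \<noteq> 0"
      have \<gamma>x: "\<gamma> x \<in> carrier G" using \<gamma> x(1) by blast
      obtain \<O> where \<O>: "\<O> \<in> conj_classes G" "\<gamma> x \<in> \<O>" using G.conj_class_exists[OF \<gamma>x] .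
      \<comment> \<open>Orders are constant on a class, so finite order of \<open>\<gamma> x\<close>
        puts its whole class into \<open>FG\<close>.\<close>
      have "\<exists>n::nat. n > 0 \<and> a [^]\<^bsub>G\<^esub> n = \<one>\<^bsub>G\<^esub>" if "a \<in> \<O>" for a
        using G.class_order_pow[OF \<O>(1) that] G.class_order_eq[OF \<O>] x(2) by auto
      then have "\<O> \<in> FG" using \<O> x(1) by (auto simp: FG_def conj_classes_fg_def)
      then have "A_gen G (\<gamma> x) [^]\<^bsub>A_group G\<^esub> G.ord (\<gamma> x) = \<iota> (0, frag_of \<O>)"
        "(0, frag_of \<O>) \<in> carrier F"
        using \<iota>_fg t[OF _ \<O>(2)] G.class_order_eq[OF \<O>] by (auto simp: F_def)
      then show "A_gen G (\<gamma> x) [^]\<^bsub>A_group G\<^esub> G.ord (\<gamma> x) \<in> \<iota> ` carrier F" by blast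
    next
      fix \<O> assume "\<O> \<in> conj_classes_ng G (\<gamma> ` \<Gamma>)"
      then have \<O>: "\<O> \<in> NG" by (simp add: NG_def)
      have "(frag_of \<O>, 0) \<in> carrier F" using \<O> by (simp add: F_def)
      then have "t_ng G \<gamma> (rep \<O>) (expr \<O>) \<in> \<iota> ` carrier F"
        using \<iota>_ng[OF \<O>] unfolding s_def by (metis imageI)
      then show "\<exists>a\<in>\<O>. \<exists>w\<in>words \<Gamma>. t_ng G \<gamma> a w \<in> \<iota> ` carrier F"
        using rep[OF \<O>] by blast
    qed
  qed
  moreover have "A_proj G ` carrier (A_group G) = carrier G"
  proof
    show "carrier G \<subseteq> A_proj G ` carrier (A_group G)"
      using G.A_proj_gen G.A_gen_closed by (metis image_eqI subsetI)
  qed auto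
  ultimately have "short_exact F (A_group G) G \<iota> (A_proj G)"
    unfolding short_exact_def K_def using \<iota>_hom G.A_proj_group_hom by blast
  then show ?thesis
    unfolding NG_def[symmetric] FG_def[symmetric] F_def
    using \<iota>_ng \<iota>_fg t by (intro exI[of _ \<iota>]) (simp add: s_def)
qed

end
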